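(* Let $b$ be a prime and $s,d\in\mathbb N$ (positive integers). Let $z,z'\in[0,1)^{ds}$ be deterministic and let the same nested uniform scrambling $\Pi$ be applied to both points. For $\boldsymbol k,\boldsymbol k'\in\mathbb N_0^{ds}$, $$\mathbb E\!\left[\operatorname{wal}_{\boldsymbol k}(\Pi(z))\,\overline{\operatorname{wal}_{\boldsymbol k'}(\Pi(z'))}\right]=0\quad\text{if }\boldsymbol k\ne\boldsymbol k'.$$ If $\boldsymbol k=\boldsymbol k'\in B_{\boldsymbol\ell}$ with $\boldsymbol\ell\in\mathbb N_0^{ds}$, then $$\mathbb E\!\left[\operatorname{wal}_{\boldsymbol k}(\Pi(z))\,\overline{\operatorname{wal}_{\boldsymbol k}(\Pi(z'))}\right]=\prod_{j=1}^{ds}\chi_{\ell_j}(z_j,z'_j).$$ In particular, the diagonal covariance depends on the frequency $\boldsymbol k$ only through its block index $\boldsymbol\ell$.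
   Context: Base-$b$ expansions of points in $[0,1)$ are chosen to be the ones not eventually equal to $b-1$. Walsh functions: for $k=\sum_{r\ge0}\kappa_rb^r\in\mathbb N_0$ and $x=\sum_{r\ge1}x_rb^{-r}\in[0,1)$, $\operatorname{wal}_k(x)=\exp\bigl(\tfrac{2\pi i}{b}\sum_{r\ge1}\kappa_{r-1}x_r\bigr)$; for vectors, $\operatorname{wal}_{\boldsymbol k}(x)=\prod_j\operatorname{wal}_{k_j}(x_j)$. Nested uniform (Owen) scrambling $\Pi$: for each coordinate $j\in\{1,\ldots,ds\}$ and each finite digit string $(a_1,\ldots,a_r)$, $r\ge0$, there is a uniformly distributed random permutation $\pi_{j;a_1,\ldots,a_r}$ of $\{0,\ldots,b-1\}$; all of these permutations are mutually independent. If $z_j=\sum_{a\ge1}z_{j,a}b^{-a}$, the $j$-th coordinate of $\Pi(z)$ has digits $\pi_{j;z_{j,1},\ldots,z_{j,r-1}}(z_{j,r})$, $r\ge1$. Blocks: $B_0=\{0\}$, $B_\ell=\{k\in\mathbb N_0:b^{\ell-1}\le k<b^\ell\}$ for $\ell\ge1$, and $B_{\boldsymbol\ell}=\prod_{j=1}^{ds}B_{\ell_j}$. For $x,x'\in[0,1)$: $\chi_0(x,x')=1$ and, for $\ell\ge1$, $$\chi_\ell(x,x')=\frac{b\,\mathbf 1_{\{\lfloor b^\ell x\rfloor=\lfloor b^\ell x'\rfloor\}}-\mathbf 1_{\{\lfloor b^{\ell-1}x\rfloor=\lfloor b^{\ell-1}x'\rfloor\}}}{b-1}.$$ *)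

theory Defs
  imports "HOL-Probability.Probability" "HOL-Combinatorics.Permutations"
    "HOL-Computational_Algebra.Primes"
begin

text \<open>
  Points and frequencies in dimension \<open>n\<close> are extensional functions on \<open>{1..n}\<close>, so that
  equality of functions is equality of the \<open>n\<close> coordinates.

  For \<open>x \<in> [0,1)\<close> the formula below yields the \<open>r\<close>-th digit (\<open>r \<ge> 1\<close>) of the
  base-\<open>b\<close> expansion of \<open>x\<close> that is not eventually equal to \<open>b - 1\<close>.
\<close>

definition digit :: "nat \<Rightarrow> real \<Rightarrow> nat \<Rightarrow> nat" where
  "digit b x r = nat (\<lfloor>real b ^ r * x\<rfloor> mod int b)"

definition nat_digit :: "nat \<Rightarrow> nat \<Rightarrow> nat \<Rightarrow> nat" where
  "nat_digit b k r = (k div b ^ r) mod b"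

text \<open>
  The summation index is shifted by one with respect to the usual
  \<open>\<kappa>\<^sub>r\<^sub>-\<^sub>1 x\<^sub>r\<close>, \<open>r \<ge> 1\<close>; only finitely many terms are nonzero.
\<close>

definition wal :: "nat \<Rightarrow> nat \<Rightarrow> real \<Rightarrow> complex" where
  "wal b k x =
     exp (2 * complex_of_real pi * \<i> / of_nat b *
       complex_of_real (\<Sum>r. real (nat_digit b k r) * real (digit b x (Suc r))))"

definition wal_vec :: "nat \<Rightarrow> nat \<Rightarrow> (nat \<Rightarrow> nat) \<Rightarrow> (nat \<Rightarrow> real) \<Rightarrow> complex" where
  "wal_vec b n k x = (\<Prod>j\<in>{1..n}. wal b (k j) (x j))"

abbreviation digit_perms :: "nat \<Rightarrow> (nat \<Rightarrow> nat) set" where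
  "digit_perms b \<equiv> {p. p permutes {..<b}}"

text \<open>
  \<open>\<pi> j as\<close> is the random permutation attached to the coordinate \<open>j\<close> and the (possibly
  empty) digit string \<open>as\<close>.
\<close>

locale nested_uniform_scrambling = prob_space M
  for M :: "'w measure" and b n :: nat and \<pi> :: "nat \<Rightarrow> nat list \<Rightarrow> 'w \<Rightarrow> nat \<Rightarrow> nat" +
  assumes uniform:
      "\<And>j as. j \<in> {1..n} \<Longrightarrow> as \<in> lists {..<b} \<Longrightarrow>
        distr M (count_space (digit_perms b)) (\<pi> j as) = uniform_count_measure (digit_perms b)"
    and independent:
      "indep_vars (\<lambda>_. count_space (digit_perms b)) (\<lambda>(j, as). \<pi> j as)
        ({1..n} \<times> lists {..<b})"

definition scrambled_digit ::
    "nat \<Rightarrow> (nat \<Rightarrow> nat list \<Rightarrow> 'w \<Rightarrow> nat \<Rightarrow> nat) \<Rightarrow> (nat \<Rightarrow> real) \<Rightarrow> 'w \<Rightarrow> nat \<Rightarrow> nat \<Rightarrow> nat" where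
  "scrambled_digit b \<pi> z \<omega> j r =
     \<pi> j (map (digit b (z j)) [1..<r]) \<omega> (digit b (z j) r)"

text \<open>
  The scrambled point is a point of Euclidean space, not a digit sequence. On a null set its
  scrambled digits may be eventually equal to \<open>b - 1\<close>; there they differ from the digits
  of the resulting number, and that number may even be \<open>1\<close>.
\<close>

definition scramble ::
    "nat \<Rightarrow> nat \<Rightarrow> (nat \<Rightarrow> nat list \<Rightarrow> 'w \<Rightarrow> nat \<Rightarrow> nat) \<Rightarrow> 'w \<Rightarrow> (nat \<Rightarrow> real) \<Rightarrow> nat \<Rightarrow> real" where
  "scramble b n \<pi> \<omega> z =
     (\<lambda>j\<in>{1..n}. \<Sum>r. real (scrambled_digit b \<pi> z \<omega> j (Suc r)) / real b ^ Suc r)"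

definition wal_product ::
    "nat \<Rightarrow> nat \<Rightarrow> (nat \<Rightarrow> nat list \<Rightarrow> 'w \<Rightarrow> nat \<Rightarrow> nat) \<Rightarrow>
      (nat \<Rightarrow> real) \<Rightarrow> (nat \<Rightarrow> real) \<Rightarrow> (nat \<Rightarrow> nat) \<Rightarrow> (nat \<Rightarrow> nat) \<Rightarrow> 'w \<Rightarrow> complex" where
  "wal_product b n \<pi> z z' k k' \<omega> =
     wal_vec b n k (scramble b n \<pi> \<omega> z) * cnj (wal_vec b n k' (scramble b n \<pi> \<omega> z'))"

definition block :: "nat \<Rightarrow> nat \<Rightarrow> nat set" where
  "block b l = (if l = 0 then {0} else {k. b ^ (l - 1) \<le> k \<and> k < b ^ l})"

definition block_vec :: "nat \<Rightarrow> nat \<Rightarrow> (nat \<Rightarrow> nat) \<Rightarrow> (nat \<Rightarrow> nat) set" where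
  "block_vec b n l = (\<Pi>\<^sub>E j\<in>{1..n}. block b (l j))"

definition chi :: "nat \<Rightarrow> nat \<Rightarrow> real \<Rightarrow> real \<Rightarrow> real" where
  "chi b l x x' =
     (if l = 0 then 1
      else (real b * of_bool (\<lfloor>real b ^ l * x\<rfloor> = \<lfloor>real b ^ l * x'\<rfloor>)
             - of_bool (\<lfloor>real b ^ (l - 1) * x\<rfloor> = \<lfloor>real b ^ (l - 1) * x'\<rfloor>))
           / (real b - 1))"

end

theory Submission
  imports Defs
begin

text \<open>
  Almost surely no scrambled digit sequence is eventually equal to \<open>b - 1\<close>, so the digits of the
  scrambled points are the permuted digits. The Walsh product is then a finite product, over
  coordinates and digit strings, of functions of the single permutation attached to that string,
  and by independence its expectation is the product of averages over uniform permutations. A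
  string on which the frequencies have different digits gives a vanishing average. For equal
  frequencies with leading digit at position \<open>l - 1\<close>, strings shorter than the first disagreement
  of the two points contribute \<open>1\<close>; a disagreement exactly at the leading digit contributes
  \<open>-1 / (b - 1)\<close>, an earlier one \<open>0\<close>.
\<close>

section \<open>Digits\<close>

lemma digit_less: "0 < b \<Longrightarrow> digit b x r < b"
  by (simp add: digit_def nat_less_iff)

lemma nat_digit_less: "0 < b \<Longrightarrow> nat_digit b k r < b"
  by (simp add: nat_digit_def)

lemma nat_digit_eq_0: "k < b ^ R \<Longrightarrow> R \<le> r \<Longrightarrow> nat_digit b k r = 0"
  using power_increasing[of R r b]
  by (cases "b = 0"; cases "R = 0") (auto simp: nat_digit_def power_0_left)

text \<open>Induction on the number of digits: the remainder modulo \<open>b\<close> is digit 0, and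
  the digits of the quotient by \<open>b\<close> are the remaining ones shifted down.\<close>

lemma nat_digits_inject:
  assumes "\<And>r. nat_digit b k r = nat_digit b k' r" "k < b ^ R" "k' < b ^ R"
  shows "k = k'"
  using assms
proof (induction R arbitrary: k k')
  case (Suc R)
  have "b > 0" using Suc.prems(2) by (cases "b = 0") auto
  have "k div b = k' div b"
  proof (rule Suc.IH)
    fix r
    show "nat_digit b (k div b) r = nat_digit b (k' div b) r"
      using Suc.prems(1)[of "Suc r"] by (simp add: nat_digit_def div_mult2_eq)
  qed (use Suc.prems \<open>b > 0\<close> in \<open>auto simp: less_mult_imp_div_less mult.commute\<close>)
  moreover have "k mod b = k' mod b"
    using Suc.prems(1)[of 0] by (simp add: nat_digit_def)
  ultimately show ?case by (metis div_mult_mod_eq)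
qed auto

text \<open>The quotient by \<open>b ^ l\<close> lies strictly between 0 and \<open>b\<close>, so
  reducing it modulo \<open>b\<close> leaves it unchanged.\<close>

lemma leading_digit_nonzero:
  assumes "b ^ l \<le> k" "k < b ^ Suc l"
  shows "nat_digit b k l \<noteq> 0"
proof -
  have "b ^ l > 0" using assms by (cases "b = 0") auto
  then have "k div b ^ l > 0" using assms by (simp add: div_greater_zero_iff)
  moreover have "k div b ^ l < b" using assms by (simp add: less_mult_imp_div_less)
  ultimately show ?thesis by (simp add: nat_digit_def)
qed

text \<open>Digits of points count from 1. The string of length \<open>r\<close> selects the
  permutation that acts on digit \<open>Suc r\<close>.\<close>

definition prefix :: "nat \<Rightarrow> real \<Rightarrow> nat \<Rightarrow> nat list" where
  "prefix b x r = map (digit b x) [1..<Suc r]"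

lemma length_prefix [simp]: "length (prefix b x r) = r"
  by (simp add: prefix_def)

lemma prefix_in_lists: "0 < b \<Longrightarrow> prefix b x r \<in> lists {..<b}"
  by (auto simp: prefix_def digit_less)

lemma prefix_Suc: "prefix b x (Suc r) = prefix b x r @ [digit b x (Suc r)]"
  by (simp add: prefix_def)

lemma prefix_eq_mono:
  assumes "prefix b x r = prefix b x' r" "q \<le> r"
  shows "prefix b x q = prefix b x' q"
  using assms by (auto simp: prefix_def)

lemma floor_power_Suc:
  assumes "0 < b"
  shows "\<lfloor>real b ^ Suc r * x\<rfloor> = int b * \<lfloor>real b ^ r * x\<rfloor> + int (digit b x (Suc r))"
proof -
  have "\<lfloor>real b ^ Suc r * x\<rfloor> div int b = \<lfloor>real b ^ Suc r * x / real_of_int (int b)\<rfloor>"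
    by (rule floor_divide_real_eq_div [symmetric]) simp
  also have "\<dots> = \<lfloor>real b ^ r * x\<rfloor>" using assms by simp
  finally show ?thesis
    using assms mult_div_mod_eq[of "int b" "\<lfloor>real b ^ Suc r * x\<rfloor>"]
    by (simp add: digit_def)
qed

text \<open>The floor is the integer whose base-\<open>b\<close> digits are the first
  \<open>r\<close> digits of the point. This translates the indicators in \<open>chi\<close> into
  agreement of prefixes.\<close>

lemma floor_eq_iff_prefix_eq:
  assumes "0 < b" "x \<in> {0..<1}" "x' \<in> {0..<1}"
  shows "\<lfloor>real b ^ r * x\<rfloor> = \<lfloor>real b ^ r * x'\<rfloor> \<longleftrightarrow> prefix b x r = prefix b x' r"
proof (induction r)
  case 0
  have "\<lfloor>x\<rfloor> = 0" "\<lfloor>x'\<rfloor> = 0" using assms by (auto simp: floor_eq_iff)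
  then show ?case by (simp add: prefix_def)
next
  case (Suc r)
  define f where "f y = \<lfloor>real b ^ r * y\<rfloor>" for y
  define c where "c y = int (digit b y (Suc r))" for y
  have c: "0 \<le> c y" "c y < int b" for y using digit_less[OF assms(1)] by (auto simp: c_def)
  \<comment> \<open>Division with remainder by \<open>b\<close> recovers both summands, so equality
    at level \<open>Suc r\<close> splits into equality at level \<open>r\<close> and of the new
    digit.\<close>
  have *: "(int b * f y + c y) div int b = f y \<and> (int b * f y + c y) mod int b = c y" for y
    using c[of y] by simp
  have "int b * f x + c x = int b * f x' + c x' \<longleftrightarrow> f x = f x' \<and> c x = c x'"
    by (metis *)
  then show ?case
    unfolding floor_power_Suc[OF assms(1)] prefix_Suc using Suc
    by (simp add: f_def c_def)
qed

section \<open>Recovering digits from a digit series\<close>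

lemma summable_expansion:
  fixes c :: "nat \<Rightarrow> nat"
  assumes b: "2 \<le> b" and c: "\<And>r. c r < b"
  shows "summable (\<lambda>r. real (c r) / real b ^ Suc r)"
proof (rule summable_comparison_test')
  show "summable (\<lambda>r. (1 / real b) ^ r)" using b by (intro summable_geometric) auto
  fix r show "norm (real (c r) / real b ^ Suc r) \<le> (1 / real b) ^ r"
    using b less_imp_le[OF c[of r]] by (simp add: field_simps)
qed

text \<open>The complementary digits \<open>b - 1 - c r\<close> complete the series to 1, and their
  own series is positive as soon as one digit differs from \<open>b - 1\<close>.\<close>

lemma expansion_less_1:
  fixes c :: "nat \<Rightarrow> nat"
  assumes b: "2 \<le> b" and c: "\<And>r. c r < b" and r: "c r \<noteq> b - 1"
  shows "(\<Sum>r. real (c r) / real b ^ Suc r) < 1"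
proof -
  let ?d = "\<lambda>r. b - 1 - c r"
  have d: "?d r < b" for r using b by simp
  note sc = summable_expansion[OF b c] and sd = summable_expansion[OF b d]
  have "0 < (\<Sum>r. real (?d r) / real b ^ Suc r)"
    by (rule suminf_pos2[OF sd, where i = r]) (use b c[of r] r in auto)
  moreover have "(\<Sum>r. real (c r) / real b ^ Suc r) + (\<Sum>r. real (?d r) / real b ^ Suc r)
      = (\<Sum>r. (real b - 1) / real b * (1 / real b) ^ r)"
    unfolding suminf_add[OF sc sd]
  proof (rule suminf_cong)
    fix r
    have "real (c r) + real (?d r) = real b - 1" using b c[of r] by simp
    then show "real (c r) / real b ^ Suc r + real (?d r) / real b ^ Suc r
        = (real b - 1) / real b * (1 / real b) ^ r"
      by (simp add: add_divide_distrib [symmetric] power_divide)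
  qed
  moreover have "(\<Sum>r. (real b - 1) / real b * (1 / real b) ^ r) = 1"
    using b by (subst suminf_mult) (simp_all add: summable_geometric suminf_geometric field_simps)
  ultimately show ?thesis by linarith
qed

lemma digit_expansion:
  fixes c :: "nat \<Rightarrow> nat"
  assumes b: "2 \<le> b" and c: "\<And>r. c r < b" and inf: "\<And>N. \<exists>r\<ge>N. c r \<noteq> b - 1"
  shows "digit b (\<Sum>r. real (c r) / real b ^ Suc r) (Suc N) = c N"
proof -
  \<comment> \<open>\<open>t N\<close> is the number left after the first \<open>N\<close> digits
    are shifted out.\<close>
  define t where "t N = (\<Sum>r. real (c (r + N)) / real b ^ Suc r)" for N
  have sum: "summable (\<lambda>r. real (c (r + N)) / real b ^ Suc r)" for N
    by (rule summable_expansion[OF b]) (rule c)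
  have t0: "0 \<le> t N" for N
    unfolding t_def by (rule suminf_nonneg[OF sum]) simp
  \<comment> \<open>Strictness needs a digit other than \<open>b - 1\<close> beyond
    \<open>N\<close>; without it the tail would equal 1 and carry into the earlier digits.\<close>
  have t1: "t N < 1" for N
  proof -
    obtain r where "r \<ge> N" "c r \<noteq> b - 1" using inf by blast
    then show ?thesis unfolding t_def
      using expansion_less_1[of b "\<lambda>r. c (r + N)" "r - N"] b c by simp
  qed
  have step: "real b * t N = real (c N) + t (Suc N)" for N
  proof -
    have "t N = (\<Sum>r. real (c (Suc r + N)) / real b ^ Suc (Suc r)) + real (c N) / real b"
      using suminf_split_head[OF sum[of N]] by (simp add: t_def)
    also have "(\<Sum>r. real (c (Suc r + N)) / real b ^ Suc (Suc r)) = t (Suc N) / real b"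
      unfolding t_def by (subst suminf_divide[OF sum, symmetric]) (simp add: field_simps)
    finally show ?thesis using b by (simp add: field_simps)
  qed
  \<comment> \<open>Scaling by \<open>b ^ N\<close> moves the first \<open>N\<close> digits into an
    integer. One further step exposes \<open>c N\<close> as the last base-\<open>b\<close> digit of
    the floor.\<close>
  have "\<exists>m::int. real b ^ N * t 0 = of_int m + t N" for N
  proof (induction N)
    case (Suc N)
    then obtain m :: int where m: "real b ^ N * t 0 = of_int m + t N" by blast
    have "real b ^ Suc N * t 0 = real b * (of_int m + t N)" by (simp add: m mult.assoc)
    also have "\<dots> = of_int (int b * m + int (c N)) + t (Suc N)"
      by (simp add: step distrib_left)
    finally show ?case by blast
  qed (auto intro: exI[of _ 0])
  then obtain m :: int where m: "real b ^ N * t 0 = of_int m + t N" by blast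
  have "real b ^ Suc N * t 0 = real b * (of_int m + t N)" by (simp add: m mult.assoc)
  also have "\<dots> = of_int (int b * m + int (c N)) + t (Suc N)"
    by (simp add: step distrib_left)
  finally have "\<lfloor>real b ^ Suc N * t 0\<rfloor> = int b * m + int (c N)"
    using t0[of "Suc N"] t1[of "Suc N"] by (simp only: floor_eq_iff) simp
  then have "digit b (t 0) (Suc N) = c N"
    using c[of N] by (simp add: digit_def)
  then show ?thesis by (simp add: t_def)
qed

section \<open>Characters and uniform permutations\<close>

definition unit_root :: "nat \<Rightarrow> complex" where
  "unit_root b = exp (2 * complex_of_real pi * \<i> / of_nat b)"

lemma unit_root_power: "unit_root b ^ a = exp (2 * of_real pi * \<i> * of_nat a / of_nat b)"
  by (simp add: unit_root_def exp_of_nat_mult [symmetric] mult_ac)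

lemma norm_unit_root: "norm (unit_root b) = 1"
  by (simp add: unit_root_def)

lemma unit_root_power_eq_iff:
  assumes "0 < b" "a < b" "a' < b"
  shows "unit_root b ^ a = unit_root b ^ a' \<longleftrightarrow> a = a'"
  using assms complex_root_unity_eq[of b a a'] by (simp add: unit_root_power cong_def)

lemma cnj_mult_unit_root_power: "unit_root b ^ a * cnj (unit_root b ^ a) = 1"
  by (simp add: complex_norm_square [symmetric] norm_power norm_unit_root flip: complex_cnj_power)

text \<open>Orthogonality of the characters of the cyclic group of order \<open>b\<close>: a
  geometric sum with ratio \<open>w\<close>, where \<open>w ^ b = 1\<close>, vanishes unless
  \<open>w = 1\<close>.\<close>

lemma sum_characters:
  assumes "0 < b" "a < b" "a' < b"
  shows "(\<Sum>x<b. unit_root b ^ (a * x) * cnj (unit_root b ^ (a' * x))) = (if a = a' then of_nat b else 0)"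
proof -
  define w where "w = unit_root b ^ a * cnj (unit_root b ^ a')"
  have "unit_root b ^ b = 1" using assms by (simp add: unit_root_power)
  then have wb: "w ^ b = 1"
    by (simp add: w_def power_mult_distrib power_mult [symmetric] mult.commute[of _ b])
       (simp add: power_mult flip: complex_cnj_power)
  have "(\<Sum>x<b. unit_root b ^ (a * x) * cnj (unit_root b ^ (a' * x))) = (\<Sum>x<b. w ^ x)"
    by (simp add: w_def power_mult power_mult_distrib)
  moreover have "w = 1 \<longleftrightarrow> a = a'"
  proof
    assume "w = 1"
    then have "unit_root b ^ a' = unit_root b ^ a * (unit_root b ^ a' * cnj (unit_root b ^ a'))"
      by (simp add: w_def mult_ac)
    also have "\<dots> = unit_root b ^ a" by (simp only: cnj_mult_unit_root_power mult_1_right)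
    finally show "a = a'" using unit_root_power_eq_iff assms by metis
  qed (simp only: w_def cnj_mult_unit_root_power)
  ultimately show ?thesis by (simp add: sum_gp_strict wb)
qed

lemma wal_eq_prod:
  assumes "k < b ^ R"
  shows "wal b k x = (\<Prod>r<R. unit_root b ^ (nat_digit b k r * digit b x (Suc r)))"
proof -
  have "(\<Sum>r. real (nat_digit b k r) * real (digit b x (Suc r)))
      = (\<Sum>r<R. real (nat_digit b k r) * real (digit b x (Suc r)))"
    by (rule suminf_finite) (auto simp: nat_digit_eq_0[OF assms])
  then have "wal b k x = exp (\<Sum>r<R. 2 * complex_of_real pi * \<i> / of_nat b *
      of_nat (nat_digit b k r * digit b x (Suc r)))"
    by (simp add: wal_def sum_distrib_left)
  also have "\<dots> = (\<Prod>r<R. unit_root b ^ (nat_digit b k r * digit b x (Suc r)))"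
    by (simp add: exp_sum unit_root_power mult_ac)
  finally show ?thesis .
qed

lemma norm_wal: "norm (wal b k x) = 1"
  by (simp add: wal_def)

section \<open>Averages over uniform permutations\<close>

definition perm_avg :: "nat \<Rightarrow> ((nat \<Rightarrow> nat) \<Rightarrow> 'a) \<Rightarrow> 'a::real_normed_field" where
  "perm_avg b f = (\<Sum>p\<in>digit_perms b. f p) / fact b"

text \<open>Right composition with a transposition permutes the permutations; it serves to exchange
  the points at which \<open>p\<close> is evaluated.\<close>

lemma sum_perms_transpose:
  assumes "u < b" "v < b"
  shows "(\<Sum>p\<in>digit_perms b. f p) = (\<Sum>p\<in>digit_perms b. f (p \<circ> Transposition.transpose u v))"
  using assms by (intro sum_permutations_compose_right permutes_swap_id) auto

lemma perm_avg_const [simp]: "perm_avg b (\<lambda>p. c) = c"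
  by (simp add: perm_avg_def card_permutations[of "{..<b}" b])

text \<open>The image of a fixed digit is uniform. By the transposition symmetry the sum is the same
  for every argument \<open>v\<close>, and for a fixed \<open>p\<close> summing over all
  \<open>v\<close> only rearranges the sum of \<open>f\<close>.\<close>

lemma perm_avg_eval:
  fixes f :: "nat \<Rightarrow> 'a::real_normed_field"
  assumes "u < b"
  shows "perm_avg b (\<lambda>p. f (p u)) = (\<Sum>x<b. f x) / of_nat b"
proof -
  have *: "(\<Sum>p\<in>digit_perms b. f (p v)) = (\<Sum>p\<in>digit_perms b. f (p u))" if "v < b" for v
    using sum_perms_transpose[of u b v "\<lambda>p. f (p v)"] assms that by simp
  have "of_nat b * (\<Sum>p\<in>digit_perms b. f (p u)) = (\<Sum>v<b. \<Sum>p\<in>digit_perms b. f (p v))"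
    by (simp add: *)
  also have "\<dots> = (\<Sum>p\<in>digit_perms b. \<Sum>v<b. f (p v))" by (rule sum.swap)
  also have "\<dots> = (\<Sum>p\<in>digit_perms b. \<Sum>x<b. f x)"
  proof (rule sum.cong [OF refl])
    fix p assume "p \<in> digit_perms b"
    then show "(\<Sum>v<b. f (p v)) = (\<Sum>x<b. f x)"
      using sum.permute[of p "{..<b}" f] by (simp add: comp_def)
  qed
  also have "\<dots> = fact b * (\<Sum>x<b. f x)"
    by (simp add: card_permutations[of "{..<b}" b])
  finally show ?thesis using assms by (simp add: perm_avg_def field_simps)
qed

lemma perm_avg_character_same:
  assumes "u < b" "a < b" "a' < b"
  shows "perm_avg b (\<lambda>p. unit_root b ^ (a * p u) * cnj (unit_root b ^ (a' * p u))) = of_bool (a = a')"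
  using perm_avg_eval[OF assms(1), of "\<lambda>x. unit_root b ^ (a * x) * cnj (unit_root b ^ (a' * x))"]
    sum_characters[of b a a'] assms by simp

text \<open>
  Summing over the second argument \<open>v\<close> gives \<open>0\<close>, and the terms with \<open>v \<noteq> u\<close> are all
  equal, so each of them is \<open>-1 / (b - 1)\<close> times the term \<open>v = u\<close>.
\<close>

lemma perm_avg_character_diff:
  assumes "u < b" "u' < b" "u \<noteq> u'" "a < b" "0 < a'" "a' < b"
  shows "perm_avg b (\<lambda>p. unit_root b ^ (a * p u) * cnj (unit_root b ^ (a' * p u')))
    = - of_bool (a = a') / (of_nat b - 1)"
proof -
  define g where "g p v = unit_root b ^ (a * p u) * cnj (unit_root b ^ (a' * p v))"
    for p :: "nat \<Rightarrow> nat" and v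
  define S where "S v = (\<Sum>p\<in>digit_perms b. g p v)" for v
  \<comment> \<open>Both \<open>v\<close> and \<open>u'\<close> differ from \<open>u\<close>, so
    exchanging them leaves the first factor untouched.\<close>
  have S_eq: "S v = S u'" if "v < b" "v \<noteq> u" for v
    unfolding S_def
    using sum_perms_transpose[of v b u' "\<lambda>p. g p v"] assms that
    by (simp add: g_def transpose_apply_other)
  have "(\<Sum>v<b. S v) = (\<Sum>p\<in>digit_perms b. \<Sum>v<b. g p v)"
    unfolding S_def by (rule sum.swap)
  \<comment> \<open>For each \<open>p\<close>, \<open>p v\<close> runs through all digits, and the
    character of the nonzero frequency \<open>a'\<close> sums to zero over them.\<close>
  also have "\<dots> = 0"
  proof (rule sum.neutral, rule ballI)
    fix p assume "p \<in> digit_perms b"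
    then have "(\<Sum>v<b. cnj (unit_root b ^ (a' * p v))) = (\<Sum>x<b. cnj (unit_root b ^ (a' * x)))"
      using sum.permute[of p "{..<b}" "\<lambda>x. cnj (unit_root b ^ (a' * x))"]
      by (simp add: comp_def)
    also have "\<dots> = 0" using sum_characters[of b 0 a'] assms by simp
    finally show "(\<Sum>v<b. g p v) = 0" by (simp add: g_def flip: sum_distrib_left)
  qed
  also have "(\<Sum>v<b. S v) = S u + (\<Sum>v\<in>{..<b} - {u}. S v)"
    using assms by (intro sum.remove) auto
  also have "(\<Sum>v\<in>{..<b} - {u}. S v) = (\<Sum>v\<in>{..<b} - {u}. S u')"
    by (intro sum.cong) (auto intro: S_eq)
  also have "\<dots> = (of_nat b - 1) * S u'" using assms by (simp add: of_nat_diff)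
  finally have "(of_nat b - 1) * S u' = - S u" by (simp add: add_eq_0_iff)
  then have "(of_nat b - 1) * (S u' / fact b) = - (S u / fact b)" by simp
  moreover have "S u / fact b = of_bool (a = a')"
    using perm_avg_character_same[of u b a a'] assms by (simp add: S_def g_def perm_avg_def)
  moreover have "of_nat b - (1::complex) \<noteq> 0" using assms by auto
  ultimately have "S u' / fact b = - of_bool (a = a') / (of_nat b - 1)"
    by (metis nonzero_mult_div_cancel_left)
  then show ?thesis by (simp only: S_def g_def perm_avg_def)
qed


lemma perm_avg_character_ne:
  assumes "u < b" "u' < b" "a < b" "a' < b" "a \<noteq> a'"
  shows "perm_avg b (\<lambda>p. unit_root b ^ (a * p u) * cnj (unit_root b ^ (a' * p u'))) = 0"
\<comment> \<open>If \<open>a' = 0\<close>, the conjugated factor is 1 wherever \<open>p\<close> is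
  evaluated, so \<open>u'\<close> may be replaced by \<open>u\<close>.\<close>
proof (cases "u = u' \<or> a' = 0")
  case True
  then show ?thesis using perm_avg_character_same[of u b a a'] assms by auto
next
  case False
  then show ?thesis using perm_avg_character_diff[of u b u' a a'] assms by simp
qed

section \<open>Factors indexed by digit strings\<close>

text \<open>
  A Walsh function of a scrambled point becomes a product over \<^emph>\<open>all\<close> short digit strings, with
  trivial factors off the prefixes of the point. For two points these products have the same
  index set, so their common permutations pair up factor by factor.
\<close>

definition wal_factor :: "nat \<Rightarrow> nat \<Rightarrow> real \<Rightarrow> nat list \<Rightarrow> (nat \<Rightarrow> nat) \<Rightarrow> complex" where
  "wal_factor b k x as p =
     (if as = prefix b x (length as)
      then unit_root b ^ (nat_digit b k (length as) * p (digit b x (Suc (length as)))) else 1)"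

definition strings :: "nat \<Rightarrow> nat \<Rightarrow> nat list set" where
  "strings b R = {as \<in> lists {..<b}. length as < R}"

definition string_cov :: "nat \<Rightarrow> nat \<Rightarrow> nat \<Rightarrow> real \<Rightarrow> real \<Rightarrow> nat list \<Rightarrow> complex" where
  "string_cov b k k' x x' as = perm_avg b (\<lambda>p. wal_factor b k x as p * cnj (wal_factor b k' x' as p))"

lemma finite_strings [simp]: "finite (strings b R)"
  by (rule finite_subset[OF _ finite_lists_length_le[of "{..<b}" R]])
     (auto simp: strings_def lists_eq_set)

lemma prefix_in_strings: "0 < b \<Longrightarrow> r < R \<Longrightarrow> prefix b x r \<in> strings b R"
  by (simp add: strings_def prefix_in_lists)

text \<open>Only the prefixes of \<open>x\<close> contribute, one for each length below
  \<open>R\<close>, and their lengths tell them apart.\<close>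

lemma prod_wal_factor:
  assumes "0 < b"
  shows "(\<Prod>as\<in>strings b R. wal_factor b k x as (P as))
    = (\<Prod>r<R. unit_root b ^ (nat_digit b k r * P (prefix b x r) (digit b x (Suc r))))"
proof -
  have inj: "inj_on (prefix b x) {..<R}" by (rule inj_on_inverseI[of _ length]) simp
  have "(\<Prod>as\<in>strings b R. wal_factor b k x as (P as))
      = (\<Prod>as\<in>prefix b x ` {..<R}. wal_factor b k x as (P as))"
  proof (rule prod.mono_neutral_right)
    show "\<forall>as\<in>strings b R - prefix b x ` {..<R}. wal_factor b k x as (P as) = 1"
      by (auto simp: wal_factor_def strings_def)
  qed (auto simp: prefix_in_strings assms)
  then show ?thesis by (simp add: prod.reindex[OF inj] wal_factor_def)
qed

section \<open>Contribution of a single string\<close>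

lemma string_cov_0:
  assumes "nat_digit b k (length as) = 0"
  shows "string_cov b k k x x' as = 1"
proof -
  have "wal_factor b k y as p = 1" for y p using assms by (simp add: wal_factor_def)
  then show ?thesis by (simp add: string_cov_def)
qed

text \<open>The two points have the same factor at \<open>as\<close>, and that factor has modulus
  1.\<close>

lemma string_cov_same:
  assumes "prefix b x (Suc (length as)) = prefix b x' (Suc (length as))"
  shows "string_cov b k k x x' as = 1"
proof -
  have "wal_factor b k x as = wal_factor b k x' as"
    using assms by (auto simp: wal_factor_def prefix_Suc)
  moreover have "wal_factor b k x' as p * cnj (wal_factor b k x' as p) = 1" for p
    unfolding wal_factor_def by (simp add: cnj_mult_unit_root_power del: complex_cnj_power)
  ultimately show ?thesis by (simp add: string_cov_def)
qed

lemma string_cov_off_prefix: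
  assumes "as \<noteq> prefix b x (length as)" "as \<noteq> prefix b x' (length as)"
  shows "string_cov b k k' x x' as = 1"
  using assms by (simp add: string_cov_def wal_factor_def)

text \<open>The string is a prefix of only one of the points, so a single nontrivial character is
  averaged against the constant 1.\<close>

lemma string_cov_eq_0_of_prefix_ne:
  assumes "0 < b" "prefix b x r \<noteq> prefix b x' r"
  shows "nat_digit b k r \<noteq> 0 \<Longrightarrow> string_cov b k k' x x' (prefix b x r) = 0"
    and "nat_digit b k' r \<noteq> 0 \<Longrightarrow> string_cov b k k' x x' (prefix b x' r) = 0"
  using assms perm_avg_character_same[of _ b _ 0] perm_avg_character_same[of _ b 0]
  by (auto simp: string_cov_def wal_factor_def digit_less nat_digit_less)

text \<open>On a common prefix, two different characters of one permutation average to 0. If the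
  prefixes differ, at least one of the frequencies has a nonzero digit, and the prefix of its point
  serves as witness.\<close>

lemma string_cov_eq_0:
  assumes "0 < b" "nat_digit b k r \<noteq> nat_digit b k' r"
  obtains as where "as \<in> lists {..<b}" "length as = r" "string_cov b k k' x x' as = 0"
proof (cases "prefix b x r = prefix b x' r")
  case True
  then have "string_cov b k k' x x' (prefix b x r) = 0"
    using perm_avg_character_ne[of _ b _ "nat_digit b k r" "nat_digit b k' r"] assms
    by (simp add: string_cov_def wal_factor_def digit_less nat_digit_less)
  then show ?thesis using that prefix_in_lists[OF assms(1)] length_prefix by blast
next
  case False
  have "nat_digit b k r \<noteq> 0 \<or> nat_digit b k' r \<noteq> 0" using assms by auto
  then show ?thesis
    using that prefix_in_lists[OF assms(1)] length_prefix
      string_cov_eq_0_of_prefix_ne[OF assms(1) False] by metis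
qed

lemma string_cov_diverging:
  assumes "0 < b" "nat_digit b k r \<noteq> 0" "prefix b x r = prefix b x' r"
    "prefix b x (Suc r) \<noteq> prefix b x' (Suc r)"
  shows "string_cov b k k x x' (prefix b x r) = - 1 / (of_nat b - 1)"
  using assms perm_avg_character_diff[of "digit b x (Suc r)" b "digit b x' (Suc r)"
      "nat_digit b k r" "nat_digit b k r"]
  by (simp add: string_cov_def wal_factor_def digit_less nat_digit_less prefix_Suc)

lemma prod_string_cov_diag:
  assumes b: "2 \<le> b" and k: "k \<in> block b l" and R: "l \<le> R"
    and x: "x \<in> {0..<1}" "x' \<in> {0..<1}"
  shows "(\<Prod>as\<in>strings b R. string_cov b k k x x' as) = complex_of_real (chi b l x x')"
proof (cases l)
  case 0
  then have "k = 0" using k by (simp add: block_def)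
  then have "string_cov b k k x x' as = 1" for as
    by (intro string_cov_0) (simp add: nat_digit_def)
  then show ?thesis by (simp add: 0 chi_def)
next
  case (Suc q)
  have b0: "0 < b" using b by simp
  have kq: "b ^ q \<le> k" "k < b ^ Suc q" using k by (auto simp: block_def Suc)
  note nz = leading_digit_nonzero[OF kq] and z = nat_digit_eq_0[OF kq(2)]
  note floor_iff = floor_eq_iff_prefix_eq[OF b0 x]
  have chi: "chi b l x x' = (real b * of_bool (prefix b x (Suc q) = prefix b x' (Suc q))
      - of_bool (prefix b x q = prefix b x' q)) / (real b - 1)"
    unfolding chi_def floor_iff by (simp add: Suc)
  have q: "prefix b x q \<in> strings b R" using R Suc b0 by (simp add: prefix_in_strings)
  \<comment> \<open>The leading digit of \<open>k\<close>, at position \<open>q\<close>, acts on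
    digit \<open>Suc q\<close> of the points. The cases place their first disagreement after, at or
    before that digit, where \<open>chi\<close> is 1, \<open>-1 / (b - 1)\<close> and 0.\<close>
  consider (same) "prefix b x (Suc q) = prefix b x' (Suc q)"
    | (div) "prefix b x q = prefix b x' q" "prefix b x (Suc q) \<noteq> prefix b x' (Suc q)"
    | (ne) "prefix b x q \<noteq> prefix b x' q" "prefix b x (Suc q) \<noteq> prefix b x' (Suc q)"
    by (auto simp: prefix_Suc)
  then show ?thesis
  proof cases
    case same
    have "string_cov b k k x x' as = 1" for as
    proof (cases "length as \<le> q")
      case True
      then show ?thesis
        by (intro string_cov_same prefix_eq_mono[OF same]) simp
    qed (auto intro!: string_cov_0 z)
    moreover have "prefix b x q = prefix b x' q" using prefix_eq_mono[OF same, of q] by simp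
    ultimately show ?thesis using b by (simp add: chi same)
  next
    case div
    \<comment> \<open>Shorter strings see agreeing digits, longer ones meet a zero digit of
      \<open>k\<close>, and others of length \<open>q\<close> lie off the common prefix.\<close>
    have "string_cov b k k x x' as = 1" if "as \<noteq> prefix b x q" for as
    proof (cases "length as" q rule: linorder_cases)
      case less
      then show ?thesis by (intro string_cov_same prefix_eq_mono[OF div(1)]) simp
    next
      case equal
      then show ?thesis using that div by (intro string_cov_off_prefix) auto
    qed (auto intro!: string_cov_0 z)
    then have "(\<Prod>as\<in>strings b R - {prefix b x q}. string_cov b k k x x' as) = 1"
      by (intro prod.neutral) auto
    then have "(\<Prod>as\<in>strings b R. string_cov b k k x x' as) = string_cov b k k x x' (prefix b x q)"
      using prod.remove[OF finite_strings q, of "string_cov b k k x x'"] by simp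
    also have "\<dots> = - 1 / (of_nat b - 1)"
      by (rule string_cov_diverging[OF b0 nz div])
    finally show ?thesis using div by (simp add: chi)
  next
    case ne
    have "string_cov b k k x x' (prefix b x q) = 0"
      by (rule string_cov_eq_0_of_prefix_ne(1)[OF b0 ne(1) nz])
    then show ?thesis using ne q by (auto simp: chi intro!: prod_zero)
  qed
qed

section \<open>Expectations over the scrambling\<close>

lemma scrambled_digit_Suc:
  "scrambled_digit b \<pi> z \<omega> j (Suc r) = \<pi> j (prefix b (z j) r) \<omega> (digit b (z j) (Suc r))"
  by (simp add: scrambled_digit_def prefix_def)

context nested_uniform_scrambling
begin

lemma perm_measurable:
  assumes "j \<in> {1..n}" "as \<in> lists {..<b}"
  shows "\<pi> j as \<in> measurable M (count_space (digit_perms b))"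
  using independent assms unfolding indep_vars_def by auto

lemma perm_permutes:
  assumes "j \<in> {1..n}" "as \<in> lists {..<b}" "\<omega> \<in> space M"
  shows "\<pi> j as \<omega> permutes {..<b}"
  using measurable_space[OF perm_measurable[OF assms(1,2)] assms(3)] by simp

lemma perm_compose_measurable:
  assumes "j \<in> {1..n}" "as \<in> lists {..<b}" "g \<in> digit_perms b \<rightarrow> space N"
  shows "(\<lambda>\<omega>. g (\<pi> j as \<omega>)) \<in> measurable M N"
  by (rule measurable_compose[OF perm_measurable[OF assms(1,2)]]) (use assms in simp)

lemma expectation_perm:
  fixes F :: "(nat \<Rightarrow> nat) \<Rightarrow> 'a::{real_normed_field, banach, second_countable_topology}"
  assumes "j \<in> {1..n}" "as \<in> lists {..<b}"
  shows "expectation (\<lambda>\<omega>. F (\<pi> j as \<omega>)) = perm_avg b F"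
proof -
  have "expectation (\<lambda>\<omega>. F (\<pi> j as \<omega>)) = integral\<^sup>L (distr M (count_space (digit_perms b)) (\<pi> j as)) F"
    by (rule integral_distr[symmetric]) (use perm_measurable assms in auto)
  also have "\<dots> = perm_avg b F"
    unfolding uniform[OF assms] uniform_count_measure_def
    by (subst lebesgue_integral_point_measure_finite)
       (auto simp: finite_permutations perm_avg_def card_permutations[of "{..<b}" b]
          scaleR_conv_of_real sum_divide_distrib)
  finally show ?thesis .
qed

text \<open>Distinct keys carry independent permutations, so expectation and product commute. Each
  factor is bounded because there are only finitely many permutations.\<close>

lemma
  fixes F :: "nat \<times> nat list \<Rightarrow> (nat \<Rightarrow> nat) \<Rightarrow> 'a::{real_normed_field, banach, second_countable_topology}"
  assumes K: "finite K" "K \<subseteq> {1..n} \<times> lists {..<b}"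
  shows expectation_prod_perms:
      "expectation (\<lambda>\<omega>. \<Prod>(j, as)\<in>K. F (j, as) (\<pi> j as \<omega>)) = (\<Prod>key\<in>K. perm_avg b (F key))"
    and integrable_prod_perms: "integrable M (\<lambda>\<omega>. \<Prod>(j, as)\<in>K. F (j, as) (\<pi> j as \<omega>))"
proof -
  let ?X = "\<lambda>key \<omega>. F key ((\<lambda>(j, as). \<pi> j as) key \<omega>)"
  have eq: "(\<lambda>\<omega>. \<Prod>(j, as)\<in>K. F (j, as) (\<pi> j as \<omega>)) = (\<lambda>\<omega>. \<Prod>key\<in>K. ?X key \<omega>)"
    by (simp add: case_prod_unfold)
  have indep: "indep_vars (\<lambda>_. borel) ?X K"
    by (rule indep_vars_compose2[OF indep_vars_subset[OF independent K(2)]]) simp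
  have int: "integrable M (?X key)" if key_in: "key \<in> K" for key
  proof (rule integrable_const_bound[of _ "Max ((\<lambda>p. norm (F key p)) ` digit_perms b)"])
    obtain j as where key: "key = (j, as)" "j \<in> {1..n}" "as \<in> lists {..<b}"
      using key_in K(2) by blast
    show "AE \<omega> in M. norm (?X key \<omega>) \<le> Max ((\<lambda>p. norm (F key p)) ` digit_perms b)"
      using perm_permutes[OF key(2,3)] by (auto simp: key(1) finite_permutations)
    show "?X key \<in> borel_measurable M"
      using indep key_in unfolding indep_vars_def by auto
  qed
  have "expectation (\<lambda>\<omega>. \<Prod>(j, as)\<in>K. F (j, as) (\<pi> j as \<omega>)) = (\<Prod>key\<in>K. expectation (?X key))"
    unfolding eq by (rule indep_vars_lebesgue_integral[OF K(1) indep int])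
  also have "\<dots> = (\<Prod>key\<in>K. perm_avg b (F key))"
  proof (rule prod.cong[OF refl])
    fix key assume "key \<in> K"
    then obtain j as where "key = (j, as)" "j \<in> {1..n}" "as \<in> lists {..<b}"
      using K(2) by blast
    then show "expectation (?X key) = perm_avg b (F key)"
      using expectation_perm[of j as "F key"] by simp
  qed
  finally show "expectation (\<lambda>\<omega>. \<Prod>(j, as)\<in>K. F (j, as) (\<pi> j as \<omega>)) = (\<Prod>key\<in>K. perm_avg b (F key))" .
  show "integrable M (\<lambda>\<omega>. \<Prod>(j, as)\<in>K. F (j, as) (\<pi> j as \<omega>))"
    unfolding eq by (rule indep_vars_integrable[OF K(1) indep int])
qed

section \<open>Almost sure digits of a scrambled point\<close>

lemma scrambled_digit_measurable:
  assumes "0 < b" "j \<in> {1..n}"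
  shows "(\<lambda>\<omega>. scrambled_digit b \<pi> z \<omega> j (Suc r)) \<in> measurable M (count_space UNIV)"
  unfolding scrambled_digit_Suc
  by (rule perm_compose_measurable) (use assms prefix_in_lists in auto)

lemma scrambled_digit_less:
  assumes "0 < b" "j \<in> {1..n}" "\<omega> \<in> space M"
  shows "scrambled_digit b \<pi> z \<omega> j (Suc r) < b"
  using permutes_in_image[OF perm_permutes[OF assms(2) prefix_in_lists[OF assms(1)] assms(3)],
      of "z j" r "digit b (z j) (Suc r)"] digit_less[OF assms(1), of "z j" "Suc r"]
  by (simp add: scrambled_digit_Suc)

text \<open>Different positions use strings of different lengths, hence independent permutations. A
  run of \<open>m\<close> scrambled digits equal to \<open>b - 1\<close> therefore has probability
  \<open>(1 / b) ^ m\<close>, which tends to 0.\<close>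

lemma AE_scrambled_digits_not_eventually:
  assumes b: "2 \<le> b" and j: "j \<in> {1..n}"
  shows "AE \<omega> in M. \<forall>N. \<exists>r\<ge>N. scrambled_digit b \<pi> z \<omega> j (Suc r) \<noteq> b - 1"
  unfolding AE_all_countable
proof
  fix N
  have b0: "0 < b" using b by simp
  note [measurable] = scrambled_digit_measurable[OF b0 j, of z]
  define A where "A = {\<omega> \<in> space M. \<forall>r\<ge>N. scrambled_digit b \<pi> z \<omega> j (Suc r) = b - 1}"
  have A [measurable]: "A \<in> sets M" unfolding A_def by measurable
  have "prob A \<le> (1 / real b) ^ m" for m
  proof -
    define key where "key r = (j, prefix b (z j) r)" for r
    have inj: "inj_on key {N..<N + m}"
      by (rule inj_on_inverseI[of _ "\<lambda>(j, as). length as"]) (simp add: key_def)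
    \<comment> \<open>The length of the string recovers the position of the digit being
      tested.\<close>
    define F :: "nat \<times> nat list \<Rightarrow> (nat \<Rightarrow> nat) \<Rightarrow> real" where
      "F = (\<lambda>(j, as) p. of_bool (p (digit b (z j) (Suc (length as))) = b - 1))"
    let ?K = "key ` {N..<N + m}"
    have K: "finite ?K" "?K \<subseteq> {1..n} \<times> lists {..<b}"
      using j prefix_in_lists[OF b0] by (auto simp: key_def)
    have "prob A = expectation (indicator A)" by simp
    also have "\<dots> \<le> expectation (\<lambda>\<omega>. \<Prod>(j, as)\<in>?K. F (j, as) (\<pi> j as \<omega>))"
    proof (rule integral_mono[OF _ integrable_prod_perms[OF K]])
      fix \<omega> assume "\<omega> \<in> space M"
      show "indicator A \<omega> \<le> (\<Prod>(j, as)\<in>?K. F (j, as) (\<pi> j as \<omega>))"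
      proof (cases "\<omega> \<in> A")
        case True
        then have "F (key r) (\<pi> j (prefix b (z j) r) \<omega>) = 1" if "r \<ge> N" for r
          using that by (simp add: F_def key_def A_def scrambled_digit_Suc)
        then have "(\<Prod>(j, as)\<in>?K. F (j, as) (\<pi> j as \<omega>)) = 1"
          by (intro prod.neutral) (auto simp: key_def)
        then show ?thesis by simp
      next
        case False
        then show ?thesis by (auto simp: F_def intro!: prod_nonneg)
      qed
    qed (rule integrable_real_indicator[OF A], simp add: less_top[symmetric])
    also have "\<dots> = (\<Prod>key\<in>?K. perm_avg b (F key))"
      by (rule expectation_prod_perms[OF K])
    also have "\<dots> = (\<Prod>r\<in>{N..<N + m}. perm_avg b (F (key r)))"
      by (simp only: prod.reindex[OF inj] comp_def)
    also have "\<dots> = (\<Prod>r\<in>{N..<N + m}. 1 / real b)"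
    proof (rule prod.cong[OF refl])
      fix r
      have "perm_avg b (F (key r)) = (\<Sum>x<b. of_bool (x = b - 1)) / real b"
        using perm_avg_eval[OF digit_less[OF b0], of "\<lambda>x. of_bool (x = b - 1) :: real" "z j" "Suc r"]
        by (simp add: F_def key_def)
      also have "(\<Sum>x<b. of_bool (x = b - 1) :: real) = 1"
        using b0 by (simp add: of_bool_def sum.delta)
      finally show "perm_avg b (F (key r)) = 1 / real b" .
    qed
    finally show ?thesis by simp
  qed
  moreover have "(\<lambda>m. (1 / real b) ^ m) \<longlonglongrightarrow> 0"
    using b by (intro LIMSEQ_power_zero) auto
  ultimately have "prob A \<le> 0" by (intro LIMSEQ_le_const) auto
  then have "prob A = 0" by (simp add: measure_le_0_iff)
  then have "AE \<omega> in M. \<omega> \<notin> A" using prob_eq_0[OF A] by simp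
  then show "AE \<omega> in M. \<exists>r\<ge>N. scrambled_digit b \<pi> z \<omega> j (Suc r) \<noteq> b - 1"
    by (auto simp: A_def elim!: AE_mp)
qed

text \<open>Off the exceptional null set, \<open>digit_expansion\<close> identifies the digits of
  the scrambled number with the permuted ones.\<close>

lemma AE_wal_scramble:
  assumes b: "2 \<le> b" and j: "j \<in> {1..n}" and k: "k < b ^ R"
  shows "AE \<omega> in M. wal b k (scramble b n \<pi> \<omega> z j)
    = (\<Prod>as\<in>strings b R. wal_factor b k (z j) as (\<pi> j as \<omega>))"
  using AE_scrambled_digits_not_eventually[OF b j, of z] AE_space
proof eventually_elim
  case (elim \<omega>)
  have b0: "0 < b" using b by simp
  have "digit b (scramble b n \<pi> \<omega> z j) (Suc r) = scrambled_digit b \<pi> z \<omega> j (Suc r)" for r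
    using digit_expansion[OF b, of "\<lambda>r. scrambled_digit b \<pi> z \<omega> j (Suc r)" r]
      scrambled_digit_less[OF b0 j elim(2)] elim(1) j
    by (simp add: scramble_def)
  then show ?case
    by (simp add: wal_eq_prod[OF k] prod_wal_factor[OF b0] scrambled_digit_Suc)
qed

text \<open>The finite product formula holds only almost surely, so measurability is derived from
  the digit formula and the defining series on the whole space.\<close>

lemma wal_product_measurable:
  assumes "0 < b"
  shows "wal_product b n \<pi> z z' k k' \<in> borel_measurable M"
proof -
  have digit [measurable]: "(\<lambda>x. digit b x r) \<in> measurable borel (count_space UNIV)" for r
    unfolding digit_def by measurable
  have wal [measurable]: "wal b k \<in> borel_measurable borel" for k
    unfolding wal_def by measurable
  have scr: "(\<lambda>\<omega>. scramble b n \<pi> \<omega> z j) \<in> borel_measurable M" if j: "j \<in> {1..n}" for j z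
  proof -
    note [measurable] = scrambled_digit_measurable[OF assms j, of z]
    have "(\<lambda>\<omega>. \<Sum>r. real (scrambled_digit b \<pi> z \<omega> j (Suc r)) / real b ^ Suc r) \<in> borel_measurable M"
      by measurable
    then show ?thesis using j by (simp add: scramble_def)
  qed
  have vec: "(\<lambda>\<omega>. wal_vec b n k (scramble b n \<pi> \<omega> z)) \<in> borel_measurable M" for k z
    unfolding wal_vec_def
    by (intro borel_measurable_prod measurable_compose[OF scr wal])
  show ?thesis unfolding wal_product_def[abs_def]
    by (intro borel_measurable_times vec measurable_compose[OF vec]
        borel_measurable_continuous_onI continuous_intros)
qed

lemma wal_product_integrable:
  assumes "0 < b"
  shows "integrable M (wal_product b n \<pi> z z' k k')"
proof (rule integrable_const_bound[of _ 1])
  show "AE \<omega> in M. norm (wal_product b n \<pi> z z' k k' \<omega>) \<le> 1"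
    by (simp add: wal_product_def wal_vec_def norm_mult norm_wal flip: prod_norm)
qed (rule wal_product_measurable[OF assms])

section \<open>Expectation of the Walsh product\<close>

lemma expectation_wal_product:
  assumes b: "2 \<le> b" and k: "\<And>j. j \<in> {1..n} \<Longrightarrow> k j < b ^ R"
    and k': "\<And>j. j \<in> {1..n} \<Longrightarrow> k' j < b ^ R"
  shows "expectation (wal_product b n \<pi> z z' k k')
    = (\<Prod>j\<in>{1..n}. \<Prod>as\<in>strings b R. string_cov b (k j) (k' j) (z j) (z' j) as)"
proof -
  \<comment> \<open>Pairing the factors of both points at each key makes every permutation occur in
    exactly one factor, even on shared strings.\<close>
  define F where "F = (\<lambda>(j, as) p.
    wal_factor b (k j) (z j) as p * cnj (wal_factor b (k' j) (z' j) as p))"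
  let ?K = "{1..n} \<times> strings b R"
  have K: "finite ?K" "?K \<subseteq> {1..n} \<times> lists {..<b}"
    by (simp, auto simp: strings_def)
  have "AE \<omega> in M. \<forall>j\<in>{1..n}. wal b (k j) (scramble b n \<pi> \<omega> z j)
      = (\<Prod>as\<in>strings b R. wal_factor b (k j) (z j) as (\<pi> j as \<omega>))"
    by (intro AE_finite_allI) (use AE_wal_scramble[OF b _ k] in auto)
  moreover have "AE \<omega> in M. \<forall>j\<in>{1..n}. wal b (k' j) (scramble b n \<pi> \<omega> z' j)
      = (\<Prod>as\<in>strings b R. wal_factor b (k' j) (z' j) as (\<pi> j as \<omega>))"
    by (intro AE_finite_allI) (use AE_wal_scramble[OF b _ k'] in auto)
  ultimately have "AE \<omega> in M. wal_product b n \<pi> z z' k k' \<omega> = (\<Prod>(j, as)\<in>?K. F (j, as) (\<pi> j as \<omega>))"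
  proof eventually_elim
    case (elim \<omega>)
    then show ?case
      by (simp add: wal_product_def wal_vec_def F_def prod.distrib prod.cartesian_product [symmetric])
  qed
  then have "expectation (wal_product b n \<pi> z z' k k')
      = expectation (\<lambda>\<omega>. \<Prod>(j, as)\<in>?K. F (j, as) (\<pi> j as \<omega>))"
    using b by (intro integral_cong_AE wal_product_measurable
        borel_measurable_integrable[OF integrable_prod_perms[OF K]]) auto
  also have "\<dots> = (\<Prod>(j, as)\<in>?K. perm_avg b (F (j, as)))"
    unfolding expectation_prod_perms[OF K] by (simp add: case_prod_unfold)
  also have "\<dots> = (\<Prod>j\<in>{1..n}. \<Prod>as\<in>strings b R. string_cov b (k j) (k' j) (z j) (z' j) as)"
    by (simp add: prod.cartesian_product F_def string_cov_def)
  finally show ?thesis .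
qed

lemma expectation_wal_product_off_diag:
  assumes b: "2 \<le> b" and k: "k \<in> {1..n} \<rightarrow>\<^sub>E UNIV" "k' \<in> {1..n} \<rightarrow>\<^sub>E UNIV" "k \<noteq> k'"
  shows "expectation (wal_product b n \<pi> z z' k k') = 0"
proof -
  \<comment> \<open>A common bound for all frequencies is also a bound on their numbers of digits,
    since \<open>R < b ^ R\<close>.\<close>
  define R where "R = (\<Sum>j\<in>{1..n}. k j + k' j)"
  have le: "k j + k' j \<le> R" if "j \<in> {1..n}" for j
    unfolding R_def by (rule member_le_sum[OF that]) auto
  have less: "m < b ^ R" if "m \<le> R" for m
    using power_gt_expt[of b R] b that by linarith
  have kR: "k j < b ^ R" "k' j < b ^ R" if "j \<in> {1..n}" for j
    using le[OF that] by (auto intro: less)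
  obtain j where j: "j \<in> {1..n}" "k j \<noteq> k' j"
    using k PiE_ext by metis
  obtain r where r: "nat_digit b (k j) r \<noteq> nat_digit b (k' j) r"
    using nat_digits_inject[of b "k j" "k' j" R] kR[OF j(1)] j(2) by blast
  \<comment> \<open>Both digits vanish from position \<open>R\<close> on, so the string that
    annihilates the product is among those of length below \<open>R\<close>.\<close>
  then have "r < R" using nat_digit_eq_0[of _ b R r] kR[OF j(1)] by (metis not_less)
  moreover obtain as where as: "as \<in> lists {..<b}" "length as = r"
      "string_cov b (k j) (k' j) (z j) (z' j) as = 0"
    using string_cov_eq_0[OF _ r] b by auto
  ultimately have "as \<in> strings b R" by (simp add: strings_def)
  then have "(\<Prod>as\<in>strings b R. string_cov b (k j) (k' j) (z j) (z' j) as) = 0"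
    using as(3) by (auto intro!: prod_zero)
  then show ?thesis
    unfolding expectation_wal_product[where k = k and k' = k', OF b kR, simplified]
    using j(1) by (auto intro!: prod_zero)
qed

lemma expectation_wal_product_diag:
  assumes b: "2 \<le> b" and k: "k \<in> block_vec b n l"
    and z: "z \<in> {1..n} \<rightarrow>\<^sub>E {0..<1}" "z' \<in> {1..n} \<rightarrow>\<^sub>E {0..<1}"
  shows "expectation (wal_product b n \<pi> z z' k k)
    = complex_of_real (\<Prod>j\<in>{1..n}. chi b (l j) (z j) (z' j))"
proof -
  \<comment> \<open>This \<open>R\<close> dominates every block index, so no leading digit is cut
    off.\<close>
  define R where "R = (\<Sum>j\<in>{1..n}. l j)"
  have lR: "l j \<le> R" if "j \<in> {1..n}" for j
    unfolding R_def by (rule member_le_sum[OF that]) auto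
  have kl: "k j \<in> block b (l j)" if "j \<in> {1..n}" for j
    using k that by (auto simp: block_vec_def)
  have kR: "k j < b ^ R" if "j \<in> {1..n}" for j
  proof -
    have "k j < b ^ l j" using kl[OF that] b by (auto simp: block_def split: if_splits)
    also have "\<dots> \<le> b ^ R" using lR[OF that] b by (intro power_increasing) auto
    finally show ?thesis .
  qed
  show ?thesis
    unfolding expectation_wal_product[where k = k and k' = k, OF b kR kR, simplified] of_real_prod
    using z by (intro prod.cong refl prod_string_cov_diag[OF b kl lR]) auto
qed

end

theorem proposition2p2:
  fixes M :: "'w measure"
    and b s d :: nat
    and \<pi> :: "nat \<Rightarrow> nat list \<Rightarrow> 'w \<Rightarrow> nat \<Rightarrow> nat"
    and z z' :: "nat \<Rightarrow> real"
  assumes "prime b" and "s \<ge> 1" and "d \<ge> 1"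
    and "nested_uniform_scrambling M b (d * s) \<pi>"
    and "z \<in> {1..d * s} \<rightarrow>\<^sub>E {0..<1}"
    and "z' \<in> {1..d * s} \<rightarrow>\<^sub>E {0..<1}"
  shows
    "(\<forall>k \<in> {1..d * s} \<rightarrow>\<^sub>E UNIV. \<forall>k' \<in> {1..d * s} \<rightarrow>\<^sub>E UNIV.
        integrable M (wal_product b (d * s) \<pi> z z' k k')) \<and>
     (\<forall>k \<in> {1..d * s} \<rightarrow>\<^sub>E UNIV. \<forall>k' \<in> {1..d * s} \<rightarrow>\<^sub>E UNIV. k \<noteq> k' \<longrightarrow>
        prob_space.expectation M (wal_product b (d * s) \<pi> z z' k k') = 0) \<and>
     (\<forall>l \<in> {1..d * s} \<rightarrow>\<^sub>E UNIV. \<forall>k \<in> block_vec b (d * s) l.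
        prob_space.expectation M (wal_product b (d * s) \<pi> z z' k k) =
          complex_of_real (\<Prod>j\<in>{1..d * s}. chi b (l j) (z j) (z' j))) \<and>
     (\<forall>l \<in> {1..d * s} \<rightarrow>\<^sub>E UNIV. \<forall>k \<in> block_vec b (d * s) l. \<forall>k' \<in> block_vec b (d * s) l.
        prob_space.expectation M (wal_product b (d * s) \<pi> z z' k k) =
        prob_space.expectation M (wal_product b (d * s) \<pi> z z' k' k'))"
proof -
  interpret nested_uniform_scrambling M b "d * s" \<pi> by fact
  have b: "2 \<le> b" using \<open>prime b\<close> by (rule prime_ge_2_nat)
  then have "0 < b" by simp
  note int = wal_product_integrable[OF this]
    and off_diag = expectation_wal_product_off_diag[OF b]
    and diag = expectation_wal_product_diag[OF b _ assms(5,6)]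
  show ?thesis
    \<comment> \<open>For two frequencies of one block, \<open>diag\<close> rewrites both
      expectations to the same product of \<open>chi\<close>.\<close>
    by (intro conjI ballI impI int off_diag) (simp_all only: diag not_False_eq_True)
qed

end
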